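(* Let $\{T_k\}_{k=0}^{\infty}$ be a family of strictly nonexpansive operators $T_k:\mathbb{R}^n\to\mathbb{R}^n$ whose set of common fixed points $F:=\bigcap_{k=0}^{\infty}\{x\in\mathbb{R}^n\mid T_k(x)=x\}$ is nonempty. Assume that for any sequence $\{x^k\}_{k=0}^{\infty}$ generated by $x^0\in\mathbb{R}^n$ arbitrary and $x^{k+1}=T_{k+1}(x^k)$ for all $k\ge 0$, the following holds: for every $\ell\ge 0$ there exists an index $k(\ell)\ge 0$ such that $$\|T_{k+1}(x^k)-z\|\le\|T_\ell(x^k)-z\|\quad\text{for all } z\in F\text{ and all }k\ge k(\ell).$$ Then any sequence $\{x^k\}_{k=0}^{\infty}$ generated by $x^0\in\mathbb{R}^n$ arbitrary and $x^{k+1}=T_{k+1}(x^k)$, $k\ge 0$, converges to an element of $F$.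
   Context: $\|\cdot\|$ is the Euclidean norm on $\mathbb{R}^n$. An operator $T:\mathbb{R}^n\to\mathbb{R}^n$ is called strictly nonexpansive if for all $x,y\in\mathbb{R}^n$: (i) $\|T(x)-T(y)\|\le\|x-y\|$, and (ii) if $\|T(x)-T(y)\|=\|x-y\|$ then $T(x)-T(y)=x-y$. *)

theory Defs
  imports "HOL-Analysis.Analysis"
begin

definition strictly_nonexpansive :: "(real ^ 'n \<Rightarrow> real ^ 'n) \<Rightarrow> bool" where
  "strictly_nonexpansive T \<longleftrightarrow>
    (\<forall>x y. norm (T x - T y) \<le> norm (x - y)) \<and>
    (\<forall>x y. norm (T x - T y) = norm (x - y) \<longrightarrow> T x - T y = x - y)"

definition common_fixed_points :: "(nat \<Rightarrow> real ^ 'n \<Rightarrow> real ^ 'n) \<Rightarrow> (real ^ 'n) set" where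
  "common_fixed_points T = (\<Inter>k. {x. T k x = x})"

text \<open>The step from index \<open>k\<close> to \<open>k + 1\<close> applies \<open>T (k + 1)\<close>, so \<open>T 0\<close> is never used to
  generate the sequence; the starting point \<open>x 0\<close> is arbitrary.\<close>

definition generated_by :: "(nat \<Rightarrow> real ^ 'n \<Rightarrow> real ^ 'n) \<Rightarrow> (nat \<Rightarrow> real ^ 'n) \<Rightarrow> bool" where
  "generated_by T x \<longleftrightarrow> (\<forall>k. x (k + 1) = T (k + 1) (x k))"

end

theory Submission
  imports Defs
begin

text \<open>The sequence is Fejer monotone with respect to \<open>F\<close>, hence bounded, and the distances to any
  \<open>z \<in> F\<close> converge. At a cluster point \<open>p\<close>, the bound
  \<open>\<parallel>x\<^sub>k\<^sub>+\<^sub>1 - z\<parallel> \<le> \<parallel>T\<^sub>l x\<^sub>k - z\<parallel> \<le> \<parallel>x\<^sub>k - z\<parallel>\<close> passes to the limit and gives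
  \<open>\<parallel>T\<^sub>l p - z\<parallel> = \<parallel>p - z\<parallel>\<close>, so \<open>T\<^sub>l p = p\<close> by strict nonexpansiveness. Thus \<open>p \<in> F\<close>, and Fejer
  monotonicity with respect to \<open>p\<close> itself upgrades subsequential convergence to convergence.\<close>

lemma strictly_nonexpansive_norm_le:
  "strictly_nonexpansive T \<Longrightarrow> norm (T x - T y) \<le> norm (x - y)"
  by (simp add: strictly_nonexpansive_def)

text \<open>Since \<open>z = T z\<close>, the norm equality is the equality case of strict
  nonexpansiveness at \<open>p\<close> and \<open>z\<close>, so
  \<open>T p - z = p - z\<close>.\<close>

lemma strictly_nonexpansive_fixed_pointI:
  assumes "strictly_nonexpansive T" "T z = z" "norm (T p - z) = norm (p - z)"
  shows "T p = p"
  using assms unfolding strictly_nonexpansive_def by (metis diff_add_cancel)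

lemma strictly_nonexpansive_tendsto:
  assumes T: "strictly_nonexpansive T" and f: "(f \<longlongrightarrow> p) net"
  shows "((\<lambda>k. T (f k)) \<longlongrightarrow> T p) net"
proof (rule Lim_null_comparison[THEN LIM_zero_cancel])
  show "\<forall>\<^sub>F k in net. norm (T (f k) - T p) \<le> norm (f k - p)"
    using strictly_nonexpansive_norm_le[OF T] by simp
  show "((\<lambda>k. norm (f k - p)) \<longlongrightarrow> 0) net"
    using f by (intro tendsto_norm_zero LIM_zero)
qed

lemma decseq_norm_imp_bounded:
  fixes x :: "nat \<Rightarrow> 'a::real_normed_vector"
  assumes "decseq (\<lambda>k. norm (x k - z))"
  shows "bounded (range x)"
proof (rule boundedI[where B = "norm (x 0 - z) + norm z"], clarify)
  fix k
  have "norm (x k) \<le> norm (x k - z) + norm z"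
    by (metis diff_add_cancel norm_triangle_ineq)
  with decseqD[OF assms, of 0 k] show "norm (x k) \<le> norm (x 0 - z) + norm z" by simp
qed

lemma decseq_norm_subseq_tendsto:
  fixes x :: "nat \<Rightarrow> 'a::real_normed_vector"
  assumes dec: "decseq (\<lambda>k. norm (x k - p))" and r: "strict_mono r" and lim: "(x \<circ> r) \<longlonglongrightarrow> p"
  shows "x \<longlonglongrightarrow> p"
proof -
  obtain L where L: "(\<lambda>k. norm (x k - p)) \<longlonglongrightarrow> L"
    using decseq_convergent[OF dec, of 0] by auto
  have "(\<lambda>k. norm (x (r k) - p)) \<longlonglongrightarrow> 0"
    using lim by (intro tendsto_norm_zero LIM_zero) (simp add: o_def)
  with LIMSEQ_subseq_LIMSEQ[OF L r] have "L = 0"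
    by (auto simp: o_def intro: LIMSEQ_unique)
  with L show ?thesis
    by (simp add: tendsto_norm_zero_iff LIM_zero_iff)
qed

lemma cluster_point_fixed:
  fixes x :: "nat \<Rightarrow> real ^ 'n"
  assumes T: "strictly_nonexpansive T" and z: "T z = z"
    and dec: "decseq (\<lambda>k. norm (x k - z))"
    and bd: "\<forall>\<^sub>F k in sequentially. norm (x (Suc k) - z) \<le> norm (T (x k) - z)"
    and r: "strict_mono r" and lim: "(x \<circ> r) \<longlonglongrightarrow> p"
  shows "T p = p"
proof -
  obtain L where L: "(\<lambda>k. norm (x k - z)) \<longlonglongrightarrow> L"
    using decseq_convergent[OF dec, of 0] by auto
  \<comment> \<open>The sandwich is applied to the full sequence, before passing to
    \<open>r\<close>: its lower bound involves \<open>x (Suc k)\<close>, and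
    \<open>Suc (r k)\<close> need not be an index of the subsequence.\<close>
  have "(\<lambda>k. norm (T (x k) - z)) \<longlonglongrightarrow> L"
    using bd always_eventually LIMSEQ_Suc[OF L] L
  proof (rule tendsto_sandwich)
    show "\<forall>k. norm (T (x k) - z) \<le> norm (x k - z)"
      using strictly_nonexpansive_norm_le[OF T, of _ z] z by simp
  qed
  from LIMSEQ_subseq_LIMSEQ[OF this r]
  have "(\<lambda>k. norm (T (x (r k)) - z)) \<longlonglongrightarrow> L" by (simp add: o_def)
  moreover have "(\<lambda>k. norm (T (x (r k)) - z)) \<longlonglongrightarrow> norm (T p - z)"
    using strictly_nonexpansive_tendsto[OF T lim] by (intro tendsto_intros) (simp add: o_def)
  ultimately have "norm (T p - z) = L" by (rule LIMSEQ_unique[symmetric])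
  moreover have "norm (p - z) = L"
  proof (rule LIMSEQ_unique)
    show "(\<lambda>k. norm (x (r k) - z)) \<longlonglongrightarrow> norm (p - z)"
      using lim by (intro tendsto_intros) (simp add: o_def)
    show "(\<lambda>k. norm (x (r k) - z)) \<longlonglongrightarrow> L"
      using LIMSEQ_subseq_LIMSEQ[OF L r] by (simp add: o_def)
  qed
  ultimately show ?thesis
    using strictly_nonexpansive_fixed_pointI[of T z p] T z by simp
qed

lemma generated_by_decseq_norm:
  assumes "\<And>k. strictly_nonexpansive (T k)" "generated_by T x" "z \<in> common_fixed_points T"
  shows "decseq (\<lambda>k. norm (x k - z))"
proof (rule decseq_SucI)
  fix k
  have "T (Suc k) z = z" "x (Suc k) = T (Suc k) (x k)"
    using assms(2,3) by (auto simp: common_fixed_points_def generated_by_def)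
  then show "norm (x (Suc k) - z) \<le> norm (x k - z)"
    using strictly_nonexpansive_norm_le[OF assms(1), of "Suc k" "x k" z] by simp
qed

theorem theorem1:
  fixes T :: "nat \<Rightarrow> real ^ 'n \<Rightarrow> real ^ 'n"
    and F :: "(real ^ 'n) set"
  defines "F \<equiv> common_fixed_points T"
  assumes "\<And>k. strictly_nonexpansive (T k)"
    and "F \<noteq> {}"
    and "\<And>x. generated_by T x \<Longrightarrow>
      \<forall>l. \<exists>k0. \<forall>z\<in>F. \<forall>k\<ge>k0. norm (T (k + 1) (x k) - z) \<le> norm (T l (x k) - z)"
  shows "\<forall>x. generated_by T x \<longrightarrow> (\<exists>z\<in>F. x \<longlonglongrightarrow> z)"
proof (intro allI impI)
  fix x assume gen: "generated_by T x"
  have dec: "decseq (\<lambda>k. norm (x k - z))" if "z \<in> F" for z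
    using generated_by_decseq_norm[of T x z] assms(2) gen that by (simp add: F_def)
  obtain z where z: "z \<in> F" using \<open>F \<noteq> {}\<close> by blast
  \<comment> \<open>Bolzano-Weierstrass in finite dimension supplies the cluster point.\<close>
  obtain p r where r: "strict_mono r" and lim: "(x \<circ> r) \<longlonglongrightarrow> p"
    using bounded_imp_convergent_subsequence[OF decseq_norm_imp_bounded[OF dec[OF z]]] by blast
  have "T l p = p" for l
  proof (rule cluster_point_fixed[OF assms(2) _ dec[OF z] _ r lim])
    show "T l z = z" using z by (auto simp: F_def common_fixed_points_def)
    \<comment> \<open>Here \<open>T (k + 1) (x k)\<close> is \<open>x (Suc k)\<close>. The threshold
      may vary with \<open>l\<close>, which is harmless as each \<open>l\<close> is treated
      separately.\<close>
    show "\<forall>\<^sub>F k in sequentially. norm (x (Suc k) - z) \<le> norm (T l (x k) - z)"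
      using assms(4)[OF gen] gen z
      by (fastforce simp: eventually_sequentially generated_by_def)
  qed
  then have p: "p \<in> F" by (simp add: F_def common_fixed_points_def)
  \<comment> \<open>Only now, with \<open>p\<close> known to lie in \<open>F\<close>, can
    \<open>dec\<close> be used with \<open>p\<close> in place of \<open>z\<close>.\<close>
  with decseq_norm_subseq_tendsto[OF dec[OF p] r lim] show "\<exists>z\<in>F. x \<longlonglongrightarrow> z" by blast
qed

end
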